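(* Let $X$ be a non-empty Lindelöf locally compact Hausdorff space, let $\mathcal{I}$ be a Riesz ideal of $C(X)$ and $\mathcal{R}$ a strictly point-separating and nowhere-vanishing Riesz subspace of $\mathcal{I}$. Then the $\mathcal{I}$-closure of $\mathcal{R}$ is all of $\mathcal{I}$.
   Context: $\mathbb{N}=\{1,2,3,\dots\}$. $C(X)$ is the space of real-valued continuous functions on $X$ with pointwise operations and pointwise order; $|f|$ is the pointwise absolute value. A Riesz ideal of $C(X)$ is a linear subspace $\mathcal{I}\subseteq C(X)$ such that $f\in C(X)$, $g\in\mathcal{I}$ and $|f|\le|g|$ imply $f\in\mathcal{I}$. A Riesz subspace of $\mathcal{I}$ is a linear subspace $\mathcal{R}\subseteq\mathcal{I}$ with $|r|\in\mathcal{R}$ for all $r\in\mathcal{R}$. A subset $S\subseteq C(X)$ is strictly point-separating if for all $x,y\in X$ with $x\ne y$ there is $s\in S$ with $s(x)\neq 0$ and $s(y)=0$; it is nowhere-vanishing if for every $x\in X$ there is $s\in S$ with $s(x)\ne 0$. A decreasing sequence $(f_k)_{k\in\mathbb{N}}$ in $\mathcal{I}$ has pointwise infimum $0$ if $\inf_{k} f_k(x)=0$ for all $x\in X$. A sequence $(g_n)_{n\in\mathbb{N}}$ in $\mathcal{I}$ is strictly $\mathcal{I}$-convergent to $\hat g\in\mathcal{I}$ if there exists a decreasing sequence $(f_k)_{k\in\mathbb{N}}$ in $\mathcal{I}$ with pointwise infimum $0$ such that for all $k\in\mathbb{N}$ there is $N\in\mathbb{N}$ with $|\hat g-g_n|\le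 f_k$ for all $n\ge N$. A subset $S\subseteq\mathcal{I}$ is $\mathcal{I}$-closed if whenever a sequence in $S$ is strictly $\mathcal{I}$-convergent to some $\hat s\in\mathcal{I}$, then $\hat s\in S$. The $\mathcal{I}$-closure of a subset $S\subseteq\mathcal{I}$ is the intersection of all $\mathcal{I}$-closed subsets of $\mathcal{I}$ that contain $S$. *)

theory Defs
  imports "HOL-Analysis.Analysis"
begin

text \<open>
  The space \<open>X\<close> is a value of type \<open>'a topology\<close>, so its points need not exhaust \<open>'a\<close>. An element of
  \<open>C(X)\<close> is represented by its extension by \<open>0\<close> outside \<open>topspace X\<close>; this makes equality in
  \<open>'a \<Rightarrow> real\<close> agree with equality of functions on \<open>X\<close> and is stable under the pointwise operations.
\<close>

definition C :: "'a topology \<Rightarrow> ('a \<Rightarrow> real) set" where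
  "C X = {f. continuous_map X euclideanreal f \<and> (\<forall>x. x \<notin> topspace X \<longrightarrow> f x = 0)}"

text \<open>The type \<open>'a \<Rightarrow> real\<close> has no \<open>real_vector\<close> instance, so \<open>subspace\<close> is written out here.\<close>

definition linear_subspace :: "('a \<Rightarrow> real) set \<Rightarrow> bool" where
  "linear_subspace V \<longleftrightarrow>
     (\<lambda>x. 0) \<in> V \<and>
     (\<forall>f\<in>V. \<forall>g\<in>V. (\<lambda>x. f x + g x) \<in> V) \<and>
     (\<forall>c. \<forall>f\<in>V. (\<lambda>x. c * f x) \<in> V)"

definition riesz_ideal :: "'a topology \<Rightarrow> ('a \<Rightarrow> real) set \<Rightarrow> bool" where
  "riesz_ideal X I \<longleftrightarrow>
     I \<subseteq> C X \<and> linear_subspace I \<and>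
     (\<forall>f\<in>C X. \<forall>g\<in>I. (\<forall>x\<in>topspace X. \<bar>f x\<bar> \<le> \<bar>g x\<bar>) \<longrightarrow> f \<in> I)"

definition riesz_subspace :: "('a \<Rightarrow> real) set \<Rightarrow> ('a \<Rightarrow> real) set \<Rightarrow> bool" where
  "riesz_subspace I R \<longleftrightarrow> R \<subseteq> I \<and> linear_subspace R \<and> (\<forall>r\<in>R. (\<lambda>x. \<bar>r x\<bar>) \<in> R)"

definition strictly_point_separating :: "'a topology \<Rightarrow> ('a \<Rightarrow> real) set \<Rightarrow> bool" where
  "strictly_point_separating X S \<longleftrightarrow>
     (\<forall>x\<in>topspace X. \<forall>y\<in>topspace X. x \<noteq> y \<longrightarrow> (\<exists>s\<in>S. s x \<noteq> 0 \<and> s y = 0))"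

definition nowhere_vanishing :: "'a topology \<Rightarrow> ('a \<Rightarrow> real) set \<Rightarrow> bool" where
  "nowhere_vanishing X S \<longleftrightarrow> (\<forall>x\<in>topspace X. \<exists>s\<in>S. s x \<noteq> 0)"

text \<open>
  Sequences are indexed from \<open>0\<close> instead of \<open>1\<close>. The conjunct \<open>bdd_below\<close> is needed because \<open>INF\<close>
  on \<open>real\<close> is unspecified for sets that are not bounded below.
\<close>

definition decreasing_to_zero :: "'a topology \<Rightarrow> (nat \<Rightarrow> 'a \<Rightarrow> real) \<Rightarrow> bool" where
  "decreasing_to_zero X f \<longleftrightarrow>
     (\<forall>x\<in>topspace X. decseq (\<lambda>k. f k x) \<and>
        bdd_below (range (\<lambda>k. f k x)) \<and> (INF k. f k x) = 0)"

definition strictly_convergent ::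
    "'a topology \<Rightarrow> ('a \<Rightarrow> real) set \<Rightarrow> (nat \<Rightarrow> 'a \<Rightarrow> real) \<Rightarrow> ('a \<Rightarrow> real) \<Rightarrow> bool" where
  "strictly_convergent X I g h \<longleftrightarrow>
     range g \<subseteq> I \<and> h \<in> I \<and>
     (\<exists>f. range f \<subseteq> I \<and> decreasing_to_zero X f \<and>
        (\<forall>k. \<exists>N. \<forall>n\<ge>N. \<forall>x\<in>topspace X. \<bar>h x - g n x\<bar> \<le> f k x))"

definition ideal_closed :: "'a topology \<Rightarrow> ('a \<Rightarrow> real) set \<Rightarrow> ('a \<Rightarrow> real) set \<Rightarrow> bool" where
  "ideal_closed X I S \<longleftrightarrow>
     S \<subseteq> I \<and> (\<forall>g h. range g \<subseteq> S \<longrightarrow> strictly_convergent X I g h \<longrightarrow> h \<in> S)"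

definition ideal_closure :: "'a topology \<Rightarrow> ('a \<Rightarrow> real) set \<Rightarrow> ('a \<Rightarrow> real) set \<Rightarrow> ('a \<Rightarrow> real) set" where
  "ideal_closure X I S = \<Inter>{T. ideal_closed X I T \<and> S \<subseteq> T}"

end

theory Submission
  imports Defs
begin

text \<open>
  Every \<open>f \<in> I\<close> is reached from \<open>R\<close> by taking strict limits twice. A Lindelof locally compact
  Hausdorff space carries continuous cutoffs \<open>0 \<le> \<phi> n \<le> 1\<close>, each vanishing outside a compact set
  \<open>K n\<close>, that increase with \<open>n\<close> and at each point are eventually equal to \<open>1\<close>
  (lemma \<open>exhausting_cutoffs\<close>).

  First, let \<open>f \<in> C X\<close> be dominated by some \<open>r \<in> R\<close>. Since \<open>R\<close> takes arbitrary prescribed values at any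
  two distinct points, the lattice form of the Stone-Weierstrass theorem approximates \<open>f\<close> by elements of \<open>R\<close> up to
  \<open>1 / (n + 1)\<close> on \<open>K n\<close>. Outside this compact set there is no control on the approximants,
  but truncating them to values between \<open>- r\<close> and \<open>r\<close> keeps them in \<open>R\<close> and makes the
  error at most \<open>2 * r\<close> everywhere. The error is therefore at most
  \<open>min (1 / (n + 1)) (2 * r) + 2 * r * (1 - \<phi> n)\<close>, which decreases to \<open>0\<close> and lies in the ideal \<open>I\<close>
  because it is dominated by \<open>4 * r\<close> (lemma \<open>dominated_is_strict_limit\<close>).

  Secondly, a general \<open>f \<in> I\<close> need not be dominated by an element of \<open>R\<close>, but each \<open>f * \<phi> n\<close> is: it has
  compact support, and on a compact set nowhere-vanishing gives elements of \<open>R\<close> as large as desired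
  (lemma \<open>compactly_supported_dominated\<close>). So it is a strict limit from \<open>R\<close> by the first step.
  Finally \<open>f * \<phi> n\<close> converges strictly to \<open>f\<close>, with regulator \<open>\<bar>f\<bar> * (1 - \<phi> n)\<close>.
\<close>

section \<open>Riesz subspaces of spaces of continuous functions\<close>

lemma C_D:
  assumes "f \<in> C X"
  shows "continuous_map X euclideanreal f" and "x \<notin> topspace X \<Longrightarrow> f x = 0"
  using assms by (auto simp: C_def)

lemma linear_subspaceD:
  assumes "linear_subspace V"
  shows "(\<lambda>x. 0) \<in> V"
    and "f \<in> V \<Longrightarrow> g \<in> V \<Longrightarrow> (\<lambda>x. f x + g x) \<in> V"
    and "f \<in> V \<Longrightarrow> (\<lambda>x. c * f x) \<in> V"
  using assms by (auto simp: linear_subspace_def)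

lemma linear_subspace_uminus:
  assumes "linear_subspace V" "f \<in> V"
  shows "(\<lambda>x. - f x) \<in> V"
  using linear_subspaceD(3)[OF assms, of "-1"] by simp

lemma riesz_idealD:
  assumes "riesz_ideal X I" "g \<in> I" "f \<in> C X"
    and "\<And>x. x \<in> topspace X \<Longrightarrow> \<bar>f x\<bar> \<le> \<bar>g x\<bar>"
  shows "f \<in> I"
  using assms unfolding riesz_ideal_def by blast

lemma riesz_subspaceD:
  assumes "riesz_subspace I R"
  shows "R \<subseteq> I" and "linear_subspace R" and "r \<in> R \<Longrightarrow> (\<lambda>x. \<bar>r x\<bar>) \<in> R"
  using assms by (auto simp: riesz_subspace_def)

lemma riesz_subspace_min:
  assumes "riesz_subspace I R" "f \<in> R" "g \<in> R"
  shows "(\<lambda>x. min (f x) (g x)) \<in> R"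
proof -
  note lin = linear_subspaceD[OF riesz_subspaceD(2)[OF assms(1)]]
  have abs: "(\<lambda>x. \<bar>f x + (-1) * g x\<bar>) \<in> R"
    using riesz_subspaceD(3)[OF assms(1) lin(2)[OF assms(2) lin(3)[OF assms(3)]]] .
  have "(\<lambda>x. (1/2) * ((f x + g x) + (-1) * \<bar>f x + (-1) * g x\<bar>)) \<in> R"
    by (rule lin(3)[OF lin(2)[OF lin(2)[OF assms(2,3)] lin(3)[OF abs]]])
  moreover have "(\<lambda>x. (1/2) * ((f x + g x) + (-1) * \<bar>f x + (-1) * g x\<bar>)) = (\<lambda>x. min (f x) (g x))"
    by (auto simp: min_def abs_if)
  ultimately show ?thesis by simp
qed

lemma riesz_subspace_max:
  assumes "riesz_subspace I R" "f \<in> R" "g \<in> R"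
  shows "(\<lambda>x. max (f x) (g x)) \<in> R"
proof -
  note neg = linear_subspace_uminus[OF riesz_subspaceD(2)[OF assms(1)]]
  have "(\<lambda>x. - min (- f x) (- g x)) \<in> R"
    using neg[OF riesz_subspace_min[OF assms(1) neg[OF assms(2)] neg[OF assms(3)]]] .
  moreover have "(\<lambda>x. - min (- f x) (- g x)) = (\<lambda>x. max (f x) (g x))"
    by (auto simp: min_def max_def)
  ultimately show ?thesis by simp
qed

lemma nowhere_vanishing_value:
  assumes "linear_subspace R" "nowhere_vanishing X R" "x \<in> topspace X"
  obtains r where "r \<in> R" "r x = a"
proof -
  obtain s where s: "s \<in> R" "s x \<noteq> 0"
    using assms(2,3) unfolding nowhere_vanishing_def by blast
  have "(\<lambda>y. (a / s x) * s y) \<in> R"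
    using linear_subspaceD(3)[OF assms(1) s(1)] .
  then show thesis by (rule that) (use s(2) in simp)
qed

lemma two_point_interpolation:
  assumes "linear_subspace R" "strictly_point_separating X R"
    and "x \<in> topspace X" "y \<in> topspace X" "x \<noteq> y"
  obtains r where "r \<in> R" "r x = a" "r y = b"
proof -
  obtain s where s: "s \<in> R" "s x \<noteq> 0" "s y = 0"
    using assms(2-5) unfolding strictly_point_separating_def by blast
  obtain t where t: "t \<in> R" "t y \<noteq> 0" "t x = 0"
    using assms(2-5) unfolding strictly_point_separating_def by metis
  have "(\<lambda>z. (a / s x) * s z + (b / t y) * t z) \<in> R"
    by (intro linear_subspaceD(2,3)[OF assms(1)] s(1) t(1))
  then show thesis by (rule that) (use s t in simp_all)
qed

section \<open>Approximation on compact sets\<close>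

text \<open>
  This is the compactness argument behind both the Stone-Weierstrass theorem and the domination of
  compactly supported functions: the strict inequality holds near each point for some member of the family,
  and the minimum of a finite subfamily satisfies it throughout \<open>K\<close>.
\<close>

lemma min_closed_family_below_on_compact:
  fixes S :: "('a \<Rightarrow> real) set"
  assumes K: "compactin X K" and "S \<noteq> {}"
    and cont: "\<And>s. s \<in> S \<Longrightarrow> continuous_map X euclideanreal s"
    and min: "\<And>s t. s \<in> S \<Longrightarrow> t \<in> S \<Longrightarrow> (\<lambda>x. min (s x) (t x)) \<in> S"
    and g: "continuous_map X euclideanreal g"
    and pt: "\<And>y. y \<in> K \<Longrightarrow> \<exists>s\<in>S. s y < g y"
  shows "\<exists>s\<in>S. \<forall>y\<in>K. s y < g y"
proof -
  define U where "U s = {y \<in> topspace X. s y < g y}" for s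
  have "openin X (U s)" if "s \<in> S" for s
  proof -
    have "continuous_map X euclideanreal (\<lambda>y. g y - s y)"
      by (intro continuous_map_diff g cont that)
    then have "openin X {y \<in> topspace X. g y - s y \<in> {0<..}}"
      by (rule openin_continuous_map_preimage) auto
    then show ?thesis by (simp add: U_def)
  qed
  moreover have "K \<subseteq> \<Union>(U ` S)"
    using pt compactin_subset_topspace[OF K] by (fastforce simp: U_def)
  ultimately obtain \<V> where "finite \<V>" "\<V> \<subseteq> U ` S" "K \<subseteq> \<Union>\<V>"
    using compactinD[OF K, of "U ` S"] by blast
  then obtain F where F: "finite F" "F \<subseteq> S" "K \<subseteq> \<Union>(U ` F)"
    by (metis finite_subset_image)
  have "\<exists>s\<in>S. \<forall>y\<in>\<Union>(U ` F). s y < g y"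
    using F(1,2)
  proof (induction F rule: finite_induct)
    case empty
    then show ?case using \<open>S \<noteq> {}\<close> by auto
  next
    case (insert t F)
    then obtain s where "s \<in> S" "\<forall>y\<in>\<Union>(U ` F). s y < g y" by auto
    with insert.prems show ?case
      by (intro bexI[OF _ min[of s t]]) (auto simp: U_def min_less_iff_disj)
  qed
  with F(3) show ?thesis by blast
qed

text \<open>
  The lattice form of the Stone-Weierstrass theorem. Minima over \<open>y\<close> of functions that agree with \<open>f\<close> at
  \<open>x\<close> and \<open>y\<close> give a function below \<open>f + e\<close> on \<open>K\<close> that agrees with \<open>f\<close> at \<open>x\<close>; maxima of such functions
  over \<open>x\<close> are moreover above \<open>f - e\<close>.
\<close>

lemma lattice_Stone_Weierstrass:
  assumes R: "riesz_subspace I R" "R \<subseteq> C X" "strictly_point_separating X R" "nowhere_vanishing X R"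
    and K: "compactin X K" and f: "continuous_map X euclideanreal f" and e: "0 < (e::real)"
  shows "\<exists>r\<in>R. \<forall>y\<in>K. \<bar>f y - r y\<bar> < e"
proof -
  note lin = riesz_subspaceD(2)[OF R(1)]
  have KX: "K \<subseteq> topspace X" by (rule compactin_subset_topspace[OF K])
  have cont: "continuous_map X euclideanreal r" if "r \<in> R" for r
    using that R(2) C_D(1) by blast
  have touching: "\<exists>r\<in>R. (\<forall>y\<in>K. r y < f y + e) \<and> r x = f x" if x: "x \<in> K" for x
  proof -
    obtain q where q: "q \<in> R" "q x = f x"
      by (rule nowhere_vanishing_value[OF lin R(4) subsetD[OF KX x]])
    have pt: "\<exists>r\<in>R. r x = f x \<and> r y < f y + e" if y: "y \<in> K" for y
    proof (cases "x = y")
      case True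
      with q e show ?thesis by (intro bexI[of _ q]) auto
    next
      case False
      obtain r where "r \<in> R" "r x = f x" "r y = f y"
        by (rule two_point_interpolation[OF lin R(3) subsetD[OF KX x] subsetD[OF KX y] False])
      with e show ?thesis by (intro bexI[of _ r]) auto
    qed
    have "\<exists>r\<in>{r \<in> R. r x = f x}. \<forall>y\<in>K. r y < f y + e"
    proof (rule min_closed_family_below_on_compact[OF K])
      show "{r \<in> R. r x = f x} \<noteq> {}" using q by blast
      show "continuous_map X euclideanreal r" if "r \<in> {r \<in> R. r x = f x}" for r
        using that cont by blast
      show "(\<lambda>z. min (r z) (t z)) \<in> {r \<in> R. r x = f x}"
        if "r \<in> {r \<in> R. r x = f x}" "t \<in> {r \<in> R. r x = f x}" for r t
        using that riesz_subspace_min[OF R(1)] by simp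
      show "continuous_map X euclideanreal (\<lambda>y. f y + e)"
        by (intro continuous_map_add f) simp
    qed (use pt in auto)
    then show ?thesis by blast
  qed
  \<comment> \<open>The negatives of the functions below \<open>f + e\<close> are taken so that their maxima become minima.\<close>
  define S where "S = {s. (\<lambda>x. - s x) \<in> R \<and> (\<forall>y\<in>K. - s y < f y + e)}"
  have neg: "(\<lambda>x. - r x) \<in> R \<longleftrightarrow> r \<in> R" for r
    using linear_subspace_uminus[OF lin, of r] linear_subspace_uminus[OF lin, of "\<lambda>x. - r x"] by auto
  have "\<exists>s\<in>S. \<forall>y\<in>K. s y < - f y + e"
  proof (rule min_closed_family_below_on_compact[OF K])
    show "S \<noteq> {}"
    proof (cases "K = {}")
      case True
      then have "(\<lambda>x. 0) \<in> S" using linear_subspaceD(1)[OF lin] by (simp add: S_def)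
      then show ?thesis by blast
    next
      case False
      then obtain r where "r \<in> R" "\<forall>y\<in>K. r y < f y + e" using touching by blast
      then have "(\<lambda>x. - r x) \<in> S" by (simp add: S_def)
      then show ?thesis by blast
    qed
    show "(\<lambda>x. min (s x) (t x)) \<in> S" if "s \<in> S" "t \<in> S" for s t
      using riesz_subspace_min[OF R(1), of s t] that neg unfolding S_def by (auto simp: min_def)
    show "\<exists>s\<in>S. s y < - f y + e" if y: "y \<in> K" for y
    proof -
      obtain r where r: "r \<in> R" "\<forall>y\<in>K. r y < f y + e" "r y = f y" using touching[OF y] by blast
      then have "(\<lambda>x. - r x) \<in> S" by (simp add: S_def)
      then show ?thesis using r(3) e by (intro bexI[of _ "\<lambda>x. - r x"]) auto
    qed
    show "continuous_map X euclideanreal s" if "s \<in> S" for s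
      using that cont neg by (simp add: S_def)
    show "continuous_map X euclideanreal (\<lambda>y. - f y + e)"
      by (intro continuous_map_add continuous_map_minus f) simp
  qed
  then obtain s where s: "s \<in> S" "\<And>y. y \<in> K \<Longrightarrow> s y < - f y + e" by blast
  have "(\<lambda>x. - s x) \<in> R" using s(1) by (simp add: S_def)
  moreover have "\<bar>f y - - s y\<bar> < e" if "y \<in> K" for y
    using s that by (fastforce simp: S_def)
  ultimately show ?thesis by (intro bexI[of _ "\<lambda>x. - s x"]) auto
qed

text \<open>
  Applied to the nonpositive elements of \<open>R\<close>, the compactness argument yields \<open>s < - \<bar>f\<bar>\<close> on \<open>K\<close>. Then \<open>- s\<close>
  dominates \<open>\<bar>f\<bar>\<close> also outside \<open>K\<close>, because it is nonnegative there while \<open>f\<close> vanishes.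
\<close>

lemma compactly_supported_dominated:
  assumes R: "riesz_subspace I R" "R \<subseteq> C X" "nowhere_vanishing X R"
    and K: "compactin X K" and f: "continuous_map X euclideanreal f"
    and supp: "\<And>x. x \<in> topspace X - K \<Longrightarrow> f x = 0"
  shows "\<exists>r\<in>R. \<forall>x\<in>topspace X. \<bar>f x\<bar> \<le> r x"
proof -
  note lin = riesz_subspaceD(2)[OF R(1)]
  have KX: "K \<subseteq> topspace X" by (rule compactin_subset_topspace[OF K])
  have "\<exists>s\<in>{r \<in> R. \<forall>x. r x \<le> 0}. \<forall>y\<in>K. s y < - \<bar>f y\<bar>"
  proof (rule min_closed_family_below_on_compact[OF K])
    show "{r \<in> R. \<forall>x. r x \<le> 0} \<noteq> {}" using linear_subspaceD(1)[OF lin] by auto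
    show "\<exists>s\<in>{r \<in> R. \<forall>x. r x \<le> 0}. s y < - \<bar>f y\<bar>" if y: "y \<in> K" for y
    proof -
      obtain r where r: "r \<in> R" "r y = \<bar>f y\<bar> + 1"
        by (rule nowhere_vanishing_value[OF lin R(3) subsetD[OF KX y]])
      have "(\<lambda>x. - \<bar>r x\<bar>) \<in> R"
        using linear_subspace_uminus[OF lin riesz_subspaceD(3)[OF R(1) r(1)]] .
      then show ?thesis using r(2) by (intro bexI[of _ "\<lambda>x. - \<bar>r x\<bar>"]) auto
    qed
    show "continuous_map X euclideanreal r" if "r \<in> {r \<in> R. \<forall>x. r x \<le> 0}" for r
      using that R(2) C_D(1) by blast
  qed (use riesz_subspace_min[OF R(1)] f in
      \<open>auto simp: min_le_iff_disj intro!: continuous_map_minus continuous_map_real_abs\<close>)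
  then obtain s where s: "s \<in> R" "\<And>x. s x \<le> 0" "\<And>y. y \<in> K \<Longrightarrow> s y < - \<bar>f y\<bar>" by blast
  have "\<bar>f x\<bar> \<le> - s x" if "x \<in> topspace X" for x
    using s(2)[of x] s(3)[of x] supp[of x] that by (cases "x \<in> K") auto
  then show ?thesis
    using linear_subspace_uminus[OF lin s(1)] by (intro bexI[of _ "\<lambda>x. - s x"]) auto
qed

section \<open>Compactly supported cutoffs\<close>

text \<open>
  Local compactness and complete regularity give bump functions with compact support; by the Lindelof property
  countably many of them, \<open>\<psi> (a 0), \<psi> (a 1), \<dots>\<close>, have no common zero. The factor \<open>n\<close> in
  \<open>min 1 (n * (\<Sum>i<n. \<psi> (a i) x))\<close> lifts every positive value to at least \<open>1\<close> in the end.
\<close>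

lemma exhausting_cutoffs:
  assumes "topspace X \<noteq> {}" "Lindelof_space X" "locally_compact_space X" "Hausdorff_space X"
  obtains \<phi> :: "nat \<Rightarrow> 'a \<Rightarrow> real" and K where
    "\<And>n. continuous_map X euclideanreal (\<phi> n)"
    "\<And>n. compactin X (K n)"
    "\<And>n x. x \<in> topspace X \<Longrightarrow> 0 \<le> \<phi> n x \<and> \<phi> n x \<le> 1"
    "\<And>n x. x \<in> topspace X - K n \<Longrightarrow> \<phi> n x = 0"
    "\<And>x. x \<in> topspace X \<Longrightarrow> incseq (\<lambda>n. \<phi> n x)"
    "\<And>x. x \<in> topspace X \<Longrightarrow> \<forall>\<^sub>F n in sequentially. \<phi> n x = 1"
proof -
  have creg: "completely_regular_space X"
    using assms(3,4) locally_compact_regular_imp_completely_regular_space by blast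
  have "\<forall>a\<in>topspace X. \<exists>\<psi> L. continuous_map X euclideanreal \<psi> \<and> compactin X L \<and>
      (\<forall>x\<in>topspace X. 0 \<le> \<psi> x) \<and> (\<forall>x\<in>topspace X - L. \<psi> x = 0) \<and> 0 < \<psi> a"
  proof
    fix a assume a: "a \<in> topspace X"
    obtain U L where UL: "openin X U" "compactin X L" "a \<in> U" "U \<subseteq> L"
      using assms(3) a unfolding locally_compact_space_def by blast
    have "closedin X (topspace X - U)" "a \<in> topspace X - (topspace X - U)"
      using UL a by auto
    then obtain h where h: "continuous_map X (top_of_set {0..1::real}) h" "h a = 0"
        "h ` (topspace X - U) \<subseteq> {1}"
      using creg unfolding completely_regular_space_def by blast
    have "continuous_map X euclideanreal h" "\<forall>x\<in>topspace X. h x \<le> 1"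
      using h(1) by (auto simp: continuous_map_in_subtopology)
    moreover have "\<forall>x\<in>topspace X - L. h x = 1" using h(3) UL(4) by auto
    ultimately show "\<exists>\<psi> L. continuous_map X euclideanreal \<psi> \<and> compactin X L \<and>
      (\<forall>x\<in>topspace X. 0 \<le> \<psi> x) \<and> (\<forall>x\<in>topspace X - L. \<psi> x = 0) \<and> 0 < \<psi> a" using h(2) UL(2)
      by (intro exI[of _ "\<lambda>x. 1 - h x"] exI[of _ L]) (auto intro: continuous_map_diff)
  qed
  from bchoice[OF this] obtain \<psi> :: "'a \<Rightarrow> 'a \<Rightarrow> real" where "\<forall>a\<in>topspace X. \<exists>L.
      continuous_map X euclideanreal (\<psi> a) \<and> compactin X L \<and> (\<forall>x\<in>topspace X. 0 \<le> \<psi> a x) \<and>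
      (\<forall>x\<in>topspace X - L. \<psi> a x = 0) \<and> 0 < \<psi> a a" ..
  from bchoice[OF this] obtain L where "\<forall>a\<in>topspace X.
      continuous_map X euclideanreal (\<psi> a) \<and> compactin X (L a) \<and> (\<forall>x\<in>topspace X. 0 \<le> \<psi> a x) \<and>
      (\<forall>x\<in>topspace X - L a. \<psi> a x = 0) \<and> 0 < \<psi> a a" ..
  then have \<psi>: "\<And>a. a \<in> topspace X \<Longrightarrow> continuous_map X euclideanreal (\<psi> a)"
      "\<And>a. a \<in> topspace X \<Longrightarrow> compactin X (L a)"
      "\<And>a x. a \<in> topspace X \<Longrightarrow> x \<in> topspace X \<Longrightarrow> 0 \<le> \<psi> a x"
      "\<And>a x. a \<in> topspace X \<Longrightarrow> x \<in> topspace X - L a \<Longrightarrow> \<psi> a x = 0"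
      "\<And>a. a \<in> topspace X \<Longrightarrow> 0 < \<psi> a a"
    by blast+
  define U where "U a = {x \<in> topspace X. \<psi> a x \<in> {0<..}}" for a
  have "openin X (U a)" if "a \<in> topspace X" for a
    unfolding U_def by (rule openin_continuous_map_preimage[OF \<psi>(1)[OF that]]) auto
  then have "openin X V" if "V \<in> U ` topspace X" for V
    using that by auto
  moreover have "\<Union>(U ` topspace X) = topspace X"
    using \<psi>(5) by (auto simp: U_def)
  ultimately obtain \<V> where \<V>: "countable \<V>" "\<V> \<subseteq> U ` topspace X" "\<Union>\<V> = topspace X"
    using Lindelof_spaceD[OF assms(2)] by meson
  then obtain A where A: "countable A" "A \<subseteq> topspace X" "\<V> = U ` A"
    by (metis countable_subset_image)
  define a where "a = from_nat_into A"
  have "A \<noteq> {}" using A(3) \<V>(3) assms(1) by (metis Union_empty image_empty)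
  then have a: "A = range a" using A(1) by (simp add: a_def)
  have aX: "a i \<in> topspace X" for i using a A(2) by auto
  define \<phi> where "\<phi> = (\<lambda>n x. min 1 (real n * (\<Sum>i<n. \<psi> (a i) x)))"
  define K where "K n = (\<Union>i<n. L (a i))" for n
  show thesis
  proof (rule that)
    show "continuous_map X euclideanreal (\<phi> n)" for n
      unfolding \<phi>_def using \<psi>(1)[OF aX]
      by (intro continuous_map_real_min continuous_map_real_mult continuous_map_sum) auto
    show "compactin X (K n)" for n
      unfolding K_def using \<psi>(2)[OF aX] by (intro compactin_Union) auto
    show "0 \<le> \<phi> n x \<and> \<phi> n x \<le> 1" if "x \<in> topspace X" for n x
      using \<psi>(3)[OF aX that] by (auto simp: \<phi>_def intro!: mult_nonneg_nonneg sum_nonneg)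
    show "\<phi> n x = 0" if "x \<in> topspace X - K n" for n x
      using \<psi>(4)[OF aX] that by (simp add: \<phi>_def K_def)
    show "incseq (\<lambda>n. \<phi> n x)" if "x \<in> topspace X" for x
    proof (rule incseq_SucI)
      fix n
      have "real n * (\<Sum>i<n. \<psi> (a i) x) \<le> real (Suc n) * (\<Sum>i<Suc n. \<psi> (a i) x)"
        using \<psi>(3)[OF aX that] by (intro mult_mono) (auto intro: sum_nonneg add_nonneg_nonneg)
      then show "\<phi> n x \<le> \<phi> (Suc n) x" unfolding \<phi>_def by (rule min.mono[OF order_refl])
    qed
    show "\<forall>\<^sub>F n in sequentially. \<phi> n x = 1" if x: "x \<in> topspace X" for x
    proof -
      obtain i where i: "0 < \<psi> (a i) x"
        using x A(3) a \<V>(3) by (auto simp: U_def)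
      show ?thesis
        using eventually_gt_at_top[of i] eventually_ge_at_top[of "nat \<lceil>1 / \<psi> (a i) x\<rceil>"]
      proof eventually_elim
        case (elim n)
        have "1 \<le> real n * \<psi> (a i) x"
          using elim(2) i by (simp add: nat_le_iff ceiling_le_iff field_simps)
        also have "\<dots> \<le> real n * (\<Sum>i<n. \<psi> (a i) x)"
          using elim(1) \<psi>(3)[OF aX x]
          by (intro mult_left_mono member_le_sum) auto
        finally show ?case by (simp add: \<phi>_def)
      qed
    qed
  qed
qed

section \<open>The two limits\<close>

lemma decreasing_to_zeroI:
  assumes "\<And>x. x \<in> topspace X \<Longrightarrow> decseq (\<lambda>k. f k x)"
    and "\<And>k x. x \<in> topspace X \<Longrightarrow> 0 \<le> f k x"
    and "\<And>x. x \<in> topspace X \<Longrightarrow> (\<lambda>k. f k x) \<longlonglongrightarrow> 0"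
  shows "decreasing_to_zero X f"
  unfolding decreasing_to_zero_def
proof (intro ballI conjI)
  fix x assume x: "x \<in> topspace X"
  show "decseq (\<lambda>k. f k x)" by (rule assms(1)[OF x])
  show bdd: "bdd_below (range (\<lambda>k. f k x))" using assms(2)[OF x] by (auto intro: bdd_belowI[of _ 0])
  show "(INF k. f k x) = 0"
    using LIMSEQ_unique[OF LIMSEQ_decseq_INF[OF bdd assms(1)[OF x]] assms(3)[OF x]] .
qed

text \<open>
  A regulating sequence that bounds the error term by term also bounds all later errors, as it decreases.
\<close>

lemma strictly_convergentI:
  assumes "\<And>n. g n \<in> I" "h \<in> I" "\<And>k. f k \<in> I" "decreasing_to_zero X f"
    and err: "\<And>n x. x \<in> topspace X \<Longrightarrow> \<bar>h x - g n x\<bar> \<le> f n x"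
  shows "strictly_convergent X I g h"
proof -
  have "\<bar>h x - g n x\<bar> \<le> f k x" if "x \<in> topspace X" "k \<le> n" for k n x
  proof -
    have "decseq (\<lambda>k. f k x)" using assms(4) that(1) by (simp add: decreasing_to_zero_def)
    then have "f n x \<le> f k x" using that(2) by (simp add: decseq_def)
    with err[OF that(1), of n] show ?thesis by linarith
  qed
  with assms(1-4) show ?thesis unfolding strictly_convergent_def by blast
qed

text \<open>
  The bound \<open>r\<close> serves twice: truncating the approximants at \<open>\<plusminus> r\<close> brings them no further from \<open>f\<close> and keeps
  the error at most \<open>2 * r\<close>, and since \<open>r\<close> lies in \<open>I\<close>, so do the functions that regulate the convergence.
\<close>

lemma dominated_is_strict_limit:
  assumes X: "topspace X \<noteq> {}" "Lindelof_space X" "locally_compact_space X" "Hausdorff_space X"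
    and I: "riesz_ideal X I"
    and R: "riesz_subspace I R" "strictly_point_separating X R" "nowhere_vanishing X R"
    and f: "f \<in> C X" and r: "r \<in> R" and fr: "\<And>x. x \<in> topspace X \<Longrightarrow> \<bar>f x\<bar> \<le> r x"
  obtains g where "range g \<subseteq> R" "strictly_convergent X I g f"
proof -
  have RI: "R \<subseteq> I" and IC: "I \<subseteq> C X" and linI: "linear_subspace I"
    using R(1) I by (auto simp: riesz_subspace_def riesz_ideal_def)
  note lin = riesz_subspaceD(2)[OF R(1)]
  obtain \<phi> :: "nat \<Rightarrow> 'a \<Rightarrow> real" and K where
    \<phi>: "\<And>n. continuous_map X euclideanreal (\<phi> n)" "\<And>n. compactin X (K n)"
      "\<And>n x. x \<in> topspace X \<Longrightarrow> 0 \<le> \<phi> n x \<and> \<phi> n x \<le> 1"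
      "\<And>n x. x \<in> topspace X - K n \<Longrightarrow> \<phi> n x = 0"
      "\<And>x. x \<in> topspace X \<Longrightarrow> incseq (\<lambda>n. \<phi> n x)"
      "\<And>x. x \<in> topspace X \<Longrightarrow> \<forall>\<^sub>F n in sequentially. \<phi> n x = 1"
    using exhausting_cutoffs[OF X] by blast
  have "\<exists>s\<in>R. \<forall>y\<in>K n. \<bar>f y - s y\<bar> < 1 / (real n + 1)" for n
    by (rule lattice_Stone_Weierstrass[OF R(1) order_trans[OF RI IC] R(2,3) \<phi>(2) C_D(1)[OF f]]) simp
  then have "\<forall>n. \<exists>s. s \<in> R \<and> (\<forall>y\<in>K n. \<bar>f y - s y\<bar> < 1 / (real n + 1))" by blast
  from choice[OF this] obtain s where
    "\<forall>n. s n \<in> R \<and> (\<forall>y\<in>K n. \<bar>f y - s n y\<bar> < 1 / (real n + 1))" ..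
  then have s: "\<And>n. s n \<in> R" "\<And>n y. y \<in> K n \<Longrightarrow> \<bar>f y - s n y\<bar> < 1 / (real n + 1)" by blast+
  define g where "g = (\<lambda>n x. max (min (s n x) (r x)) (- r x))"
  define e where "e = (\<lambda>n x. min (1 / (real n + 1)) (2 * r x) + 2 * r x * (1 - \<phi> n x))"
  have r0: "0 \<le> r x" if "x \<in> topspace X" for x using fr[OF that] by linarith
  have rC: "r \<in> C X" using r RI IC by blast
  have gR: "g n \<in> R" for n
    unfolding g_def
    by (intro riesz_subspace_max[OF R(1)] riesz_subspace_min[OF R(1)] s(1) r linear_subspace_uminus[OF lin])
  have eI: "e n \<in> I" for n
  proof (rule riesz_idealD[OF I])
    show "(\<lambda>x. 4 * r x) \<in> I" by (rule linear_subspaceD(3)[OF linI subsetD[OF RI r]])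
    have "continuous_map X euclideanreal (e n)"
      unfolding e_def using C_D(1)[OF rC] \<phi>(1)
      by (intro continuous_map_add continuous_map_real_min continuous_map_real_mult continuous_map_diff) auto
    then show "e n \<in> C X"
      using C_D(2)[OF rC] by (simp add: C_def e_def)
    fix x assume x: "x \<in> topspace X"
    have "0 \<le> 2 * r x * (1 - \<phi> n x)" "2 * r x * (1 - \<phi> n x) \<le> 2 * r x"
      using r0[OF x] \<phi>(3)[OF x, of n] by (simp, intro mult_left_le) auto
    then show "\<bar>e n x\<bar> \<le> \<bar>4 * r x\<bar>"
      using r0[OF x] unfolding e_def by (simp add: min_def)
  qed
  have "strictly_convergent X I g f"
  proof (rule strictly_convergentI[where f = e])
    show "g n \<in> I" for n using gR RI by blast
    show "f \<in> I" by (rule riesz_idealD[OF I _ f]) (use r RI fr r0 in auto)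
    show "decreasing_to_zero X e"
    proof (rule decreasing_to_zeroI)
      fix x assume x: "x \<in> topspace X"
      show "0 \<le> e k x" for k
        using r0[OF x] \<phi>(3)[OF x, of k] by (auto simp: e_def intro!: add_nonneg_nonneg mult_nonneg_nonneg)
      show "decseq (\<lambda>k. e k x)"
        unfolding e_def
      proof (intro decseq_SucI add_mono min.mono mult_left_mono diff_left_mono order_refl)
        show "1 / (real (Suc k) + 1) \<le> 1 / (real k + 1)" for k by (simp add: field_simps)
        show "\<phi> k x \<le> \<phi> (Suc k) x" for k by (rule incseq_SucD[OF \<phi>(5)[OF x]])
        show "0 \<le> 2 * r x" using r0[OF x] by simp
      qed simp
      have "(\<lambda>k. min (1 / (real k + 1)) (2 * r x)) \<longlonglongrightarrow> min 0 (2 * r x)"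
        using LIMSEQ_inverse_real_of_nat by (intro tendsto_min tendsto_const) (simp add: inverse_eq_divide add.commute)
      moreover have "(\<lambda>k. 2 * r x * (1 - \<phi> k x)) \<longlonglongrightarrow> 0"
        by (rule tendsto_eventually) (use \<phi>(6)[OF x] in \<open>auto elim: eventually_mono\<close>)
      ultimately show "(\<lambda>k. e k x) \<longlonglongrightarrow> 0"
        using tendsto_add r0[OF x] unfolding e_def by fastforce
    qed
    fix n x assume x: "x \<in> topspace X"
    have err: "\<bar>f x - g n x\<bar> \<le> \<bar>f x - s n x\<bar>" "\<bar>f x - g n x\<bar> \<le> 2 * r x"
      using fr[OF x] by (auto simp: g_def max_def min_def)
    show "\<bar>f x - g n x\<bar> \<le> e n x"
    proof (cases "x \<in> K n")
      case True
      have "0 \<le> 2 * r x * (1 - \<phi> n x)" using r0[OF x] \<phi>(3)[OF x, of n] by simp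
      then show ?thesis using err s(2)[OF True] by (simp add: e_def)
    next
      case False
      then have "e n x = min (1 / (real n + 1)) (2 * r x) + 2 * r x"
        using \<phi>(4)[of x n] x by (simp add: e_def)
      moreover have "0 \<le> min (1 / (real n + 1)) (2 * r x)" using r0[OF x] by simp
      ultimately show ?thesis using err(2) by linarith
    qed
  qed (rule eI)
  then show thesis using that gR by blast
qed

theorem theorem4p1:
  fixes X :: "'a topology" and I R :: "('a \<Rightarrow> real) set"
  assumes "topspace X \<noteq> {}"
    and "Lindelof_space X"
    and "locally_compact_space X"
    and "Hausdorff_space X"
    and "riesz_ideal X I"
    and "riesz_subspace I R"
    and "strictly_point_separating X R"
    and "nowhere_vanishing X R"
  shows "ideal_closure X I R = I"
proof
  have RI: "R \<subseteq> I" and IC: "I \<subseteq> C X"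
    using assms(5,6) by (auto simp: riesz_subspace_def riesz_ideal_def)
  have "ideal_closed X I I" by (auto simp: ideal_closed_def strictly_convergent_def)
  with RI show "ideal_closure X I R \<subseteq> I" by (auto simp: ideal_closure_def)
  show "I \<subseteq> ideal_closure X I R"
    unfolding ideal_closure_def
  proof (intro subsetI InterI, elim CollectE conjE)
    fix f T assume f: "f \<in> I" and T: "ideal_closed X I T" "R \<subseteq> T"
    have fC: "f \<in> C X" using f IC by blast
    obtain \<phi> :: "nat \<Rightarrow> 'a \<Rightarrow> real" and K where
      \<phi>: "\<And>n. continuous_map X euclideanreal (\<phi> n)" "\<And>n. compactin X (K n)"
        "\<And>n x. x \<in> topspace X \<Longrightarrow> 0 \<le> \<phi> n x \<and> \<phi> n x \<le> 1"
        "\<And>n x. x \<in> topspace X - K n \<Longrightarrow> \<phi> n x = 0"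
        "\<And>x. x \<in> topspace X \<Longrightarrow> incseq (\<lambda>n. \<phi> n x)"
        "\<And>x. x \<in> topspace X \<Longrightarrow> \<forall>\<^sub>F n in sequentially. \<phi> n x = 1"
      using exhausting_cutoffs[OF assms(1-4)] by blast
    define g where "g = (\<lambda>n x. f x * \<phi> n x)"
    define e where "e = (\<lambda>n x. \<bar>f x\<bar> * (1 - \<phi> n x))"
    have gC: "g n \<in> C X" for n
      using C_D[OF fC] \<phi>(1) by (auto simp: C_def g_def intro!: continuous_map_real_mult)
    have eC: "e n \<in> C X" for n
      using C_D[OF fC] \<phi>(1)
      by (auto simp: C_def e_def intro!: continuous_map_real_mult continuous_map_real_abs continuous_map_diff)
    have gT: "g n \<in> T" for n
    proof -
      have "\<exists>r\<in>R. \<forall>x\<in>topspace X. \<bar>g n x\<bar> \<le> r x"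
      proof (rule compactly_supported_dominated
          [OF assms(6) order_trans[OF RI IC] assms(8) \<phi>(2) C_D(1)[OF gC]])
        show "g n x = 0" if "x \<in> topspace X - K n" for x
          using \<phi>(4)[OF that] by (simp add: g_def)
      qed
      then obtain r where r: "r \<in> R" "\<And>x. x \<in> topspace X \<Longrightarrow> \<bar>g n x\<bar> \<le> r x" by blast
      obtain h where "range h \<subseteq> R" "strictly_convergent X I h (g n)"
        using dominated_is_strict_limit[OF assms gC r] .
      then show ?thesis using T unfolding ideal_closed_def by blast
    qed
    have "strictly_convergent X I g f"
    proof (rule strictly_convergentI[where f = e])
      show "g n \<in> I" for n using gT T(1) by (auto simp: ideal_closed_def)
      show "e n \<in> I" for n
      proof (rule riesz_idealD[OF assms(5) f eC])
        fix x assume "x \<in> topspace X"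
        then show "\<bar>e n x\<bar> \<le> \<bar>f x\<bar>" using \<phi>(3)[of x n]
          by (auto simp: e_def abs_mult intro!: mult_left_le)
      qed
      show "decreasing_to_zero X e"
      proof (rule decreasing_to_zeroI)
        fix x assume x: "x \<in> topspace X"
        show "0 \<le> e k x" for k using \<phi>(3)[OF x, of k] by (simp add: e_def)
        show "decseq (\<lambda>k. e k x)"
          unfolding e_def
          by (intro decseq_SucI mult_left_mono diff_left_mono abs_ge_zero incseq_SucD \<phi>(5) x)
        show "(\<lambda>k. e k x) \<longlonglongrightarrow> 0"
          by (rule tendsto_eventually) (use \<phi>(6)[OF x] in \<open>auto simp: e_def elim: eventually_mono\<close>)
      qed
      show "\<bar>f x - g n x\<bar> \<le> e n x" if "x \<in> topspace X" for n x
      proof -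
        have "f x - g n x = f x * (1 - \<phi> n x)" by (simp add: g_def algebra_simps)
        then show ?thesis using \<phi>(3)[OF that, of n] by (simp add: e_def abs_mult)
      qed
    qed (rule f)
    then show "f \<in> T" using T(1) gT unfolding ideal_closed_def by blast
  qed
qed

end
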